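(* Let $A$ and $B$ be Banach algebras with bounded approximate identities, let $(E^{<},E^{>})$ be a Morita equivalence between them, and suppose $(A_0,B_0,E_0^{<},E_0^{>})$ is a compatible dense subcontext. Then, for every closed two-sided ideal $I$ of $B$, $$I\in\mathcal G(B;B_0)\quad\Longleftrightarrow\quad \operatorname{Ind}_B^A(I)\in\mathcal G(A;A_0).$$ Consequently, Morita induction restricts to an order isomorphism $$\operatorname{Ind}_B^A:\mathcal G(B;B_0)\xrightarrow{\ \cong\ }\mathcal G(A;A_0).$$
   Context: All Banach spaces and Banach algebras are complex, and all Banach module actions are contractive. For a subset $S$ of a Banach space, $\overline{\operatorname{span}}\,S$ is its closed linear span. For sets $S,T$ a pairing symbol applied to $(S,T)$ denotes the set of all values on $S\times T$; juxtaposition of linear subspaces denotes the linear span of all products. A bounded approximate identity in a Banach algebra $A$ is a net $(u_\lambda)$ with $\sup_\lambda\|u_\lambda\|<\infty$ and $u_\lambda a\to a$, $au_\lambda\to a$ for every $a\in A$. A Morita equivalence $(E^{<},E^{>})$ between Banach algebras $A$ and $B$ consists of a Banach $B$-$A$-bimodule $E^{<}$, a Banach $A$-$B$-bimodule $E^{>}$, and continuous bilinear pairings $\langle\cdot,\cdot\rangle_B:E^{<}\times E^{>}\to B$ and ${}_A\langle\cdot,\cdot\rangle:E^{>}\times E^{<}\to A$ of norm at most one such that, for all $e^{<},f^{<}\in E^{<}$, $e^{>},f^{>}\in E^{>}$, $a\in A$, $b\in B$: (i) $\langle be^{<},e^{>}\rangle_B=b\langle e^{<},e^{>}\rangle_B$,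 $\langle e^{<},e^{>}b\rangle_B=\langle e^{<},e^{>}\rangle_Bb$, ${}_A\langle ae^{>},e^{<}\rangle=a\,{}_A\langle e^{>},e^{<}\rangle$, ${}_A\langle e^{>},e^{<}a\rangle={}_A\langle e^{>},e^{<}\rangle a$; (ii) $\langle e^{<}a,e^{>}\rangle_B=\langle e^{<},ae^{>}\rangle_B$, ${}_A\langle e^{>}b,e^{<}\rangle={}_A\langle e^{>},be^{<}\rangle$; (iii) $\langle e^{<},e^{>}\rangle_Bf^{<}=e^{<}\,{}_A\langle e^{>},f^{<}\rangle$, $e^{>}\langle f^{<},f^{>}\rangle_B={}_A\langle e^{>},f^{<}\rangle f^{>}$; (iv) both pairings are full: $\overline{\operatorname{span}}\,\langle E^{<},E^{>}\rangle_B=B$ and $\overline{\operatorname{span}}\,{}_A\langle E^{>},E^{<}\rangle=A$; (v) all four module actions are nondegenerate, i.e. the linear span of the module products is dense in the module. For a closed two-sided ideal $I$ of $B$ put $E_I^{>}=\{\xi\in E^{>}:\langle\eta,\xi\rangle_B\in I\ \forall\eta\in E^{<}\}$ and $\operatorname{Ind}_B^A(I)=\overline{\operatorname{span}}\,{}_A\langle E_I^{>},E^{<}\rangle$, a closed two-sided ideal of $A$. A compatible dense subcontext $(A_0,B_0,E_0^{<},E_0^{>})$ of $(E^{<},E^{>})$ consists of dense subalgebras $A_0\subseteq A$, $B_0\subseteq B$ and dense linear subspaces $E_0^{<}\subseteq E^{<}$, $E_0^{>}\subseteq E^{>}$ satisfying $B_0E_0^{<}\subseteq E_0^{<}$, $E_0^{<}A_0\subseteq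 E_0^{<}$, $A_0E_0^{>}\subseteq E_0^{>}$, $E_0^{>}B_0\subseteq E_0^{>}$, $\langle E_0^{<},E_0^{>}\rangle_B\subseteq B_0$ and ${}_A\langle E_0^{>},E_0^{<}\rangle\subseteq A_0$. For a dense subalgebra $A_0\subseteq A$, a closed two-sided ideal $J$ of $A$ is $A_0$-geometric if $\overline{J\cap A_0}=J$; $\mathcal G(A;A_0)$ is the set of $A_0$-geometric closed two-sided ideals, ordered by inclusion (similarly $\mathcal G(B;B_0)$). *)

theory Defs
  imports "HOL-Analysis.Analysis"
begin

section \<open>Complex Banach spaces and Banach algebras\<close>

class complex_vector = real_vector +
  fixes scaleC :: "complex \<Rightarrow> 'a \<Rightarrow> 'a" (infixr "*\<^sub>C" 75)
  assumes scaleC_add_right: "c *\<^sub>C (x + y) = c *\<^sub>C x + c *\<^sub>C y"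
    and scaleC_add_left: "(c + d) *\<^sub>C x = c *\<^sub>C x + d *\<^sub>C x"
    and scaleC_scaleC: "c *\<^sub>C (d *\<^sub>C x) = (c * d) *\<^sub>C x"
    and scaleC_of_real: "complex_of_real r *\<^sub>C x = r *\<^sub>R x"

class complex_normed_vector = complex_vector + real_normed_vector +
  assumes norm_scaleC: "norm (c *\<^sub>C x) = cmod c * norm x"

class complex_banach = complex_normed_vector + banach

text \<open>Algebras are not assumed to be unital, and may be zero.\<close>

class complex_banach_algebra = complex_banach + real_normed_algebra +
  assumes mult_scaleC_left: "(c *\<^sub>C x) * y = c *\<^sub>C (x * y)"
    and mult_scaleC_right: "x * (c *\<^sub>C y) = c *\<^sub>C (x * y)"

global_interpretation complex_vector:
  vector_space "scaleC :: complex \<Rightarrow> 'a \<Rightarrow> 'a::complex_vector"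
proof
  show "1 *\<^sub>C x = x" for x :: 'a
    using scaleC_of_real [of 1 x] by simp
qed (fact scaleC_add_right scaleC_add_left scaleC_scaleC)+

abbreviation (input) cspan :: "'a::complex_vector set \<Rightarrow> 'a set"
  where "cspan \<equiv> complex_vector.span"

abbreviation (input) csubspace :: "'a::complex_vector set \<Rightarrow> bool"
  where "csubspace \<equiv> complex_vector.subspace"

definition contractive_bilinear ::
    "('x::complex_normed_vector \<Rightarrow> 'y::complex_normed_vector \<Rightarrow> 'z::complex_normed_vector) \<Rightarrow> bool"
  where "contractive_bilinear f \<longleftrightarrow>
    (\<forall>x. Vector_Spaces.linear scaleC scaleC (\<lambda>y. f x y)) \<and>
    (\<forall>y. Vector_Spaces.linear scaleC scaleC (\<lambda>x. f x y)) \<and>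
    (\<forall>x y. norm (f x y) \<le> norm x * norm y)"

definition all_values :: "('x \<Rightarrow> 'y \<Rightarrow> 'z) \<Rightarrow> 'x set \<Rightarrow> 'y set \<Rightarrow> 'z set"
  where "all_values f S T = {f s t | s t. s \<in> S \<and> t \<in> T}"

definition subalgebra :: "'a::complex_banach_algebra set \<Rightarrow> bool"
  where "subalgebra S \<longleftrightarrow> csubspace S \<and> (\<forall>x\<in>S. \<forall>y\<in>S. x * y \<in> S)"

definition closed_ideal :: "'a::complex_banach_algebra set \<Rightarrow> bool"
  where "closed_ideal J \<longleftrightarrow>
    closed J \<and> csubspace J \<and> (\<forall>x\<in>J. \<forall>a. a * x \<in> J \<and> x * a \<in> J)"


section \<open>Bounded approximate identities\<close>

text \<open>A net is a function on a type carrying a directed preorder; \<open>net_filter\<close> is its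
  filter of tails, so that convergence along it is convergence of the net.\<close>

definition directed_preorder :: "('i \<Rightarrow> 'i \<Rightarrow> bool) \<Rightarrow> bool"
  where "directed_preorder le \<longleftrightarrow>
    reflp le \<and> transp le \<and> (\<forall>i j. \<exists>k. le i k \<and> le j k)"

definition net_filter :: "('i \<Rightarrow> 'i \<Rightarrow> bool) \<Rightarrow> 'i filter"
  where "net_filter le = (INF i. principal {j. le i j})"

definition bounded_approximate_identity ::
    "('i \<Rightarrow> 'i \<Rightarrow> bool) \<Rightarrow> ('i \<Rightarrow> 'a::complex_banach_algebra) \<Rightarrow> bool"
  where "bounded_approximate_identity le u \<longleftrightarrow>
    directed_preorder le \<and> bounded (range u) \<and>
    (\<forall>a. ((\<lambda>i. u i * a) \<longlongrightarrow> a) (net_filter le) \<and> ((\<lambda>i. a * u i) \<longlongrightarrow> a) (net_filter le))"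


section \<open>Morita equivalences\<close>

definition banach_bimodule ::
    "('a::complex_banach_algebra \<Rightarrow> 'e \<Rightarrow> 'e) \<Rightarrow> ('e \<Rightarrow> 'b::complex_banach_algebra \<Rightarrow> 'e::complex_banach) \<Rightarrow> bool"
  where "banach_bimodule l r \<longleftrightarrow>
    contractive_bilinear l \<and> contractive_bilinear r \<and>
    (\<forall>a a' e. l (a * a') e = l a (l a' e)) \<and>
    (\<forall>e b b'. r e (b * b') = r (r e b) b') \<and>
    (\<forall>a e b. r (l a e) b = l a (r e b))"

text \<open>The type \<open>'l\<close> is $E^{<}$ (a \<open>'b\<close>-\<open>'a\<close>-bimodule) and \<open>'r\<close> is $E^{>}$
  (an \<open>'a\<close>-\<open>'b\<close>-bimodule). The actions \<open>lB\<close>, \<open>lA\<close> are from the left and \<open>rA\<close>, \<open>rB\<close> from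
  the right; \<open>pB\<close>, \<open>pA\<close> are the pairings with values in \<open>'b\<close> and \<open>'a\<close>.\<close>

locale morita_equivalence =
  fixes lB :: "'b::complex_banach_algebra \<Rightarrow> 'l::complex_banach \<Rightarrow> 'l"
    and rA :: "'l \<Rightarrow> 'a::complex_banach_algebra \<Rightarrow> 'l"
    and lA :: "'a \<Rightarrow> 'r::complex_banach \<Rightarrow> 'r"
    and rB :: "'r \<Rightarrow> 'b \<Rightarrow> 'r"
    and pB :: "'l \<Rightarrow> 'r \<Rightarrow> 'b"
    and pA :: "'r \<Rightarrow> 'l \<Rightarrow> 'a"
  assumes bimodule_l: "banach_bimodule lB rA"
    and bimodule_r: "banach_bimodule lA rB"
    and pairing_B: "contractive_bilinear pB"
    and pairing_A: "contractive_bilinear pA"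
    and pB_left: "pB (lB b e) x = b * pB e x"
    and pB_right: "pB e (rB x b) = pB e x * b"
    and pA_left: "pA (lA a x) e = a * pA x e"
    and pA_right: "pA x (rA e a) = pA x e * a"
    and pB_balanced: "pB (rA e a) x = pB e (lA a x)"
    and pA_balanced: "pA (rB x b) e = pA x (lB b e)"
    and pairings_l: "lB (pB e x) f = rA e (pA x f)"
    and pairings_r: "rB x (pB f y) = lA (pA x f) y"
    and full_B: "closure (cspan (all_values pB UNIV UNIV)) = UNIV"
    and full_A: "closure (cspan (all_values pA UNIV UNIV)) = UNIV"
    and nondegenerate_lB: "closure (cspan (all_values lB UNIV UNIV)) = UNIV"
    and nondegenerate_rA: "closure (cspan (all_values rA UNIV UNIV)) = UNIV"
    and nondegenerate_lA: "closure (cspan (all_values lA UNIV UNIV)) = UNIV"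
    and nondegenerate_rB: "closure (cspan (all_values rB UNIV UNIV)) = UNIV"

definition ideal_submodule :: "('l \<Rightarrow> 'r \<Rightarrow> 'b) \<Rightarrow> 'b set \<Rightarrow> 'r set"
  where "ideal_submodule pB I = {x. \<forall>e. pB e x \<in> I}"

definition morita_ind ::
    "('l \<Rightarrow> 'r \<Rightarrow> 'b) \<Rightarrow> ('r \<Rightarrow> 'l \<Rightarrow> 'a::complex_banach_algebra) \<Rightarrow> 'b set \<Rightarrow> 'a set"
  where "morita_ind pB pA I = closure (cspan (all_values pA (ideal_submodule pB I) UNIV))"


section \<open>Dense subcontexts and geometric ideals\<close>

definition dense_subalgebra :: "'a::complex_banach_algebra set \<Rightarrow> bool"
  where "dense_subalgebra S \<longleftrightarrow> subalgebra S \<and> closure S = UNIV"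

definition dense_subspace :: "'e::complex_banach set \<Rightarrow> bool"
  where "dense_subspace S \<longleftrightarrow> csubspace S \<and> closure S = UNIV"

definition compatible_dense_subcontext ::
    "('b::complex_banach_algebra \<Rightarrow> 'l::complex_banach \<Rightarrow> 'l) \<Rightarrow>
     ('l \<Rightarrow> 'a::complex_banach_algebra \<Rightarrow> 'l) \<Rightarrow>
     ('a \<Rightarrow> 'r::complex_banach \<Rightarrow> 'r) \<Rightarrow> ('r \<Rightarrow> 'b \<Rightarrow> 'r) \<Rightarrow>
     ('l \<Rightarrow> 'r \<Rightarrow> 'b) \<Rightarrow> ('r \<Rightarrow> 'l \<Rightarrow> 'a) \<Rightarrow>
     'a set \<Rightarrow> 'b set \<Rightarrow> 'l set \<Rightarrow> 'r set \<Rightarrow> bool"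
  where "compatible_dense_subcontext lB rA lA rB pB pA A0 B0 L0 R0 \<longleftrightarrow>
    dense_subalgebra A0 \<and> dense_subalgebra B0 \<and> dense_subspace L0 \<and> dense_subspace R0 \<and>
    cspan (all_values lB B0 L0) \<subseteq> L0 \<and> cspan (all_values rA L0 A0) \<subseteq> L0 \<and>
    cspan (all_values lA A0 R0) \<subseteq> R0 \<and> cspan (all_values rB R0 B0) \<subseteq> R0 \<and>
    all_values pB L0 R0 \<subseteq> B0 \<and> all_values pA R0 L0 \<subseteq> A0"

definition geometric_ideals :: "'a::complex_banach_algebra set \<Rightarrow> 'a set set"
  where "geometric_ideals A0 = {J. closed_ideal J \<and> closure (J \<inter> A0) = J}"

definition inclusion_isomorphism ::
    "('b set \<Rightarrow> 'a set) \<Rightarrow> 'b set set \<Rightarrow> 'a set set \<Rightarrow> bool"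
  where "inclusion_isomorphism f P Q \<longleftrightarrow>
    bij_betw f P Q \<and> (\<forall>I\<in>P. \<forall>J\<in>P. I \<subseteq> J \<longleftrightarrow> f I \<subseteq> f J)"

end

theory Submission imports Defs begin

text \<open>The inverse of induction is induction along the reversed equivalence. Nondegeneracy, fullness
  and the bounded approximate identities put every \<open>x\<close> into the closed linear span of the
  \<open>rB y (pB e x) = lA (pA y e) x\<close>. Hence the submodule of \<open>I\<close> is the closed linear span of the
  \<open>rB y b\<close> with \<open>b \<in> I\<close>, and induction of \<open>I\<close> is the closed linear span of the elements
  \<open>pA (rB y b) e\<close>. If \<open>I\<close> is geometric, \<open>y\<close>, \<open>b\<close>, \<open>e\<close> can be taken from the subcontext,
  so the induced ideal is geometric; the converse is the same fact for the reversed equivalence.\<close>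

section \<open>Closed complex subspaces and contractive bilinear maps\<close>

lemma bounded_linear_scaleC:
  "bounded_linear (scaleC c :: 'a::complex_normed_vector \<Rightarrow> 'a)"
proof (rule bounded_linear_intro [where K = "cmod c"])
  fix x y :: 'a and r :: real
  show "c *\<^sub>C (x + y) = c *\<^sub>C x + c *\<^sub>C y"
    by (rule scaleC_add_right)
  show "c *\<^sub>C (r *\<^sub>R x) = r *\<^sub>R (c *\<^sub>C x)"
    by (metis mult.commute scaleC_of_real scaleC_scaleC)
  show "norm (c *\<^sub>C x) \<le> norm x * cmod c"
    by (simp add: norm_scaleC)
qed

lemma csubspace_closure:
  fixes S :: "'a::complex_normed_vector set"
  assumes "csubspace S"
  shows "csubspace (closure S)"
  unfolding complex_vector.subspace_def
proof (intro conjI ballI allI)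
  show "0 \<in> closure S"
    using assms closure_subset complex_vector.subspace_0 by blast
  show "x + y \<in> closure S" if "x \<in> closure S" "y \<in> closure S" for x y
  proof -
    obtain f g where "\<forall>n. f n \<in> S" "f \<longlonglongrightarrow> x" "\<forall>n. g n \<in> S" "g \<longlonglongrightarrow> y"
      using \<open>x \<in> closure S\<close> \<open>y \<in> closure S\<close> unfolding closure_sequential by auto
    then show ?thesis
      unfolding closure_sequential
      by (intro exI [of _ "\<lambda>n. f n + g n"])
        (auto intro: tendsto_add complex_vector.subspace_add [OF assms])
  qed
  show "c *\<^sub>C x \<in> closure S" if "x \<in> closure S" for c x
  proof -
    obtain f where "\<forall>n. f n \<in> S" "f \<longlonglongrightarrow> x"
      using \<open>x \<in> closure S\<close> unfolding closure_sequential by auto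
    then show ?thesis
      unfolding closure_sequential
      by (intro exI [of _ "\<lambda>n. c *\<^sub>C f n"])
        (auto intro: bounded_linear.tendsto [OF bounded_linear_scaleC]
          complex_vector.subspace_scale [OF assms])
  qed
qed

lemma csubspace_closure_cspan [simp]:
  "csubspace (closure (cspan (S :: 'a::complex_normed_vector set)))"
  by (simp add: csubspace_closure)

lemma closure_cspan_minimal:
  assumes "S \<subseteq> C" "closed C" "csubspace C"
  shows "closure (cspan S) \<subseteq> (C :: 'a::complex_normed_vector set)"
  by (simp add: assms closure_minimal complex_vector.span_minimal)

lemma closure_cspan_base: "x \<in> S \<Longrightarrow> x \<in> closure (cspan (S :: 'a::complex_normed_vector set))"
  using closure_subset complex_vector.span_base by blast

lemma all_valuesE:
  assumes "z \<in> all_values f S T"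
  obtains s t where "z = f s t" "s \<in> S" "t \<in> T"
  using assms unfolding all_values_def by blast

lemma all_values_mem_closure_cspan:
  "\<lbrakk>s \<in> S; t \<in> T\<rbrakk> \<Longrightarrow> f s t \<in> closure (cspan (all_values f S T :: 'a::complex_normed_vector set))"
  by (rule closure_cspan_base) (auto simp: all_values_def)

text \<open>The preimage of \<open>C\<close> under \<open>f\<close> is again a closed subspace, so
  it contains the closed linear span of \<open>S\<close> once it contains \<open>S\<close>. Every
  later reduction to generators rests on this, applied to one variable at a time.\<close>

lemma linear_closure_cspan_mem:
  fixes f :: "'a::complex_normed_vector \<Rightarrow> 'b::complex_normed_vector"
  assumes "Vector_Spaces.linear scaleC scaleC f" "bounded_linear f"
    and "closed C" "csubspace C" "\<And>x. x \<in> S \<Longrightarrow> f x \<in> C" "x \<in> closure (cspan S)"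
  shows "f x \<in> C"
proof -
  have "closed (f -` C)"
    using assms(2,3) by (simp add: continuous_closed_vimage linear_continuous_at)
  moreover have "csubspace (f -` C)"
    using assms(1,4) by (meson Vector_Spaces.linear.axioms(3) module_hom.subspace_vimage)
  ultimately have "closure (cspan S) \<subseteq> f -` C"
    using assms(5) by (intro closure_cspan_minimal) auto
  then show ?thesis
    using assms(6) by blast
qed

lemma contractive_bilinear_flip:
  "contractive_bilinear f \<Longrightarrow> contractive_bilinear (\<lambda>x y. f y x)"
  by (auto simp: contractive_bilinear_def mult.commute)

lemma contractive_bilinear_imp_linear:
  "contractive_bilinear f \<Longrightarrow> Vector_Spaces.linear scaleC scaleC (f x)"
  by (simp add: contractive_bilinear_def)

lemma clinear_imp_bounded_linear:
  fixes f :: "'a::complex_normed_vector \<Rightarrow> 'b::complex_normed_vector"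
  assumes "Vector_Spaces.linear scaleC scaleC f" "\<And>x. norm (f x) \<le> norm x * K"
  shows "bounded_linear f"
proof (rule bounded_linear_intro [where K = K])
  interpret f: Vector_Spaces.linear scaleC scaleC f
    by (fact assms(1))
  show "f (x + y) = f x + f y" for x y
    by (rule f.add)
  show "f (r *\<^sub>R x) = r *\<^sub>R f x" for r x
    by (metis f.scale scaleC_of_real)
qed (fact assms(2))

lemma contractive_bilinear_imp_bounded_linear:
  assumes "contractive_bilinear f"
  shows "bounded_linear (f x)"
proof (rule clinear_imp_bounded_linear [where K = "norm x"])
  show "norm (f x y) \<le> norm y * norm x" for y
    using assms by (simp add: contractive_bilinear_def mult.commute)
qed (rule contractive_bilinear_imp_linear [OF assms])

lemma contractive_bilinear_closure_cspan_right:
  assumes "contractive_bilinear f" "closed C" "csubspace C"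
    and "\<And>y. y \<in> T \<Longrightarrow> f x y \<in> C" "y \<in> closure (cspan T)"
  shows "f x y \<in> C"
  using linear_closure_cspan_mem [where f = "f x" and C = C and S = T]
    contractive_bilinear_imp_linear contractive_bilinear_imp_bounded_linear assms
  by blast

lemma contractive_bilinear_closure_cspan_left:
  assumes "contractive_bilinear f" "closed C" "csubspace C"
    and "\<And>x. x \<in> S \<Longrightarrow> f x y \<in> C" "x \<in> closure (cspan S)"
  shows "f x y \<in> C"
  using contractive_bilinear_closure_cspan_right [where f = "\<lambda>y x. f x y" and C = C and T = S]
    contractive_bilinear_flip assms
  by blast

lemma contractive_bilinear_mult:
  "contractive_bilinear ((*) :: 'a::complex_banach_algebra \<Rightarrow> 'a \<Rightarrow> 'a)"
proof -
  have "Vector_Spaces.linear scaleC scaleC (\<lambda>y. x * y)"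
       "Vector_Spaces.linear scaleC scaleC (\<lambda>y. y * x)" for x :: 'a
    by (unfold_locales; simp add: algebra_simps mult_scaleC_left mult_scaleC_right)+
  then show ?thesis
    by (simp add: contractive_bilinear_def norm_mult_ineq)
qed

text \<open>Multiplication by a fixed element is bounded and linear, so absorption passes from
  generators to their closed linear span.\<close>

lemma closed_ideal_closure_cspan:
  assumes "\<And>a x. x \<in> S \<Longrightarrow> a * x \<in> closure (cspan S)"
    and "\<And>a x. x \<in> S \<Longrightarrow> x * a \<in> closure (cspan S)"
  shows "closed_ideal (closure (cspan S))"
  unfolding closed_ideal_def
proof (intro conjI ballI allI)
  fix x a assume x: "x \<in> closure (cspan S)"
  show "a * x \<in> closure (cspan S)"
    by (rule contractive_bilinear_closure_cspan_right [OF contractive_bilinear_mult _ _ _ x])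
      (use assms in auto)
  show "x * a \<in> closure (cspan S)"
    by (rule contractive_bilinear_closure_cspan_left [OF contractive_bilinear_mult _ _ _ x])
      (use assms in auto)
qed auto

section \<open>Approximate identities acting on nondegenerate modules\<close>

lemma net_filter_neq_bot:
  assumes "directed_preorder le"
  shows "net_filter le \<noteq> bot"
  unfolding net_filter_def
proof (rule INF_filter_not_bot)
  fix F :: "'a set" assume "finite F"
  then have "\<exists>k. \<forall>i\<in>F. le i k"
  proof induction
    case (insert j F)
    then obtain k where "\<forall>i\<in>F. le i k"
      by blast
    moreover obtain m where "le j m" "le k m"
      using assms unfolding directed_preorder_def by blast
    moreover have "transp le"
      using assms unfolding directed_preorder_def by blast
    ultimately show ?case
      by (metis insert_iff transpD)
  qed simp
  then show "(INF i\<in>F. principal {j. le i j}) \<noteq> bot"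
    using \<open>finite F\<close> by (auto simp: INF_principal_finite principal_eq_bot_iff)
qed

text \<open>The points at which the maps tend to zero form a subspace, which settles the span; the
  bound \<open>K\<close>, uniform in \<open>i\<close>, then carries convergence to the closure by an
  \<epsilon>/2 argument.\<close>

lemma tendsto_zero_closure_cspan:
  fixes f :: "'i \<Rightarrow> 'a::complex_normed_vector \<Rightarrow> 'b::complex_normed_vector"
  assumes lin: "\<And>i. Vector_Spaces.linear scaleC scaleC (f i)"
    and bound: "\<And>i x. norm (f i x) \<le> norm x * K"
    and zero: "\<And>x. x \<in> S \<Longrightarrow> ((\<lambda>i. f i x) \<longlongrightarrow> 0) F"
    and x: "x \<in> closure (cspan S)"
  shows "((\<lambda>i. f i x) \<longlongrightarrow> 0) F"
proof -
  have "csubspace {y. ((\<lambda>i. f i y) \<longlongrightarrow> 0) F}"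
    unfolding complex_vector.subspace_def
  proof (intro conjI ballI allI; clarsimp)
    interpret f: Vector_Spaces.linear scaleC scaleC "f i" for i
      by (fact lin)
    show "((\<lambda>i. f i 0) \<longlongrightarrow> 0) F"
      by (simp add: f.zero)
    show "((\<lambda>i. f i (y + z)) \<longlongrightarrow> 0) F"
      if "((\<lambda>i. f i y) \<longlongrightarrow> 0) F" "((\<lambda>i. f i z) \<longlongrightarrow> 0) F" for y z
      using tendsto_add [OF that] by (simp add: f.add)
    show "((\<lambda>i. f i (c *\<^sub>C y)) \<longlongrightarrow> 0) F" if "((\<lambda>i. f i y) \<longlongrightarrow> 0) F" for c y
      using bounded_linear.tendsto [OF bounded_linear_scaleC that] by (simp add: f.scale)
  qed
  then have span: "((\<lambda>i. f i y) \<longlongrightarrow> 0) F" if "y \<in> cspan S" for y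
    using complex_vector.span_minimal [of S "{y. ((\<lambda>i. f i y) \<longlongrightarrow> 0) F}"] zero that by blast
  show ?thesis
  proof (rule tendstoI)
    fix \<epsilon> :: real assume "\<epsilon> > 0"
    \<comment> \<open>Nothing forces \<open>K\<close> to be positive, and the choice of
      \<open>y\<close> divides by the bound.\<close>
    define L where "L = max K 1"
    have L: "L > 0" "K \<le> L"
      by (auto simp: L_def)
    obtain y where y: "y \<in> cspan S" "dist y x < \<epsilon> / (2 * L)"
      using x \<open>\<epsilon> > 0\<close> L by (metis closure_approachable divide_pos_pos mult_pos_pos zero_less_numeral)
    have "eventually (\<lambda>i. dist (f i y) 0 < \<epsilon> / 2) F"
      using \<open>\<epsilon> > 0\<close> by (intro tendstoD [OF span [OF y(1)]]) simp
    then show "eventually (\<lambda>i. dist (f i x) 0 < \<epsilon>) F"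
    proof eventually_elim
      case (elim i)
      interpret f: Vector_Spaces.linear scaleC scaleC "f i"
        by (fact lin)
      have "norm (f i (x - y)) \<le> norm (x - y) * K"
        by (rule bound)
      also have "\<dots> \<le> norm (x - y) * L"
        using L by (simp add: mult_left_mono)
      also have "\<dots> < \<epsilon> / 2"
        using y(2) L by (simp add: dist_norm norm_minus_commute field_simps)
      finally have "norm (f i x - f i y) < \<epsilon> / 2"
        by (simp add: f.diff)
      moreover have "norm (f i x) \<le> norm (f i y) + norm (f i x - f i y)"
        by (metis norm_triangle_sub)
      ultimately show ?case
        using elim by simp
    qed
  qed
qed

text \<open>The net also acts as an approximate identity on the module: \<open>l (u i) x - x\<close>
  tends to zero at products \<open>x = l a y\<close> because \<open>u i * a\<close> tends to
  \<open>a\<close>, and by nondegeneracy these products span a dense subspace.\<close>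

lemma nondegenerate_left_mem_closure:
  fixes u :: "'i \<Rightarrow> 'a::complex_banach_algebra" and l :: "'a \<Rightarrow> 'e::complex_banach \<Rightarrow> 'e"
  assumes bai: "bounded_approximate_identity le u"
    and l: "contractive_bilinear l" "\<And>a a' e. l (a * a') e = l a (l a' e)"
    and nondegenerate: "closure (cspan (all_values l UNIV UNIV)) = UNIV"
  shows "e \<in> closure (range (\<lambda>a. l a e))"
proof -
  let ?F = "net_filter le"
  obtain K where K: "\<And>i. norm (u i) \<le> K"
    using bai unfolding bounded_approximate_identity_def bounded_iff by blast
  have linl: "Vector_Spaces.linear scaleC scaleC (l a)" for a
    using l(1) by (rule contractive_bilinear_imp_linear)
  have lin: "Vector_Spaces.linear scaleC scaleC (\<lambda>x. l (u i) x - x)" for i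
  proof -
    interpret Vector_Spaces.linear scaleC scaleC "l (u i)"
      by (fact linl)
    show ?thesis
      by unfold_locales
        (simp_all add: add scale complex_vector.scale_right_diff_distrib)
  qed
  have "((\<lambda>i. l (u i) e - e) \<longlongrightarrow> 0) ?F"
  \<comment> \<open>The action of \<open>u i\<close> contributes \<open>K\<close> by contractivity,
    the subtracted identity contributes 1.\<close>
  proof (rule tendsto_zero_closure_cspan [OF lin, where K = "K + 1" and S = "all_values l UNIV UNIV"])
    show "norm (l (u i) x - x) \<le> norm x * (K + 1)" for i x
    proof -
      have "norm (l (u i) x - x) \<le> norm (l (u i) x) + norm x"
        by (rule norm_triangle_ineq4)
      also have "norm (l (u i) x) \<le> norm (u i) * norm x"
        using l(1) by (simp add: contractive_bilinear_def)
      also have "\<dots> \<le> K * norm x"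
        using K by (simp add: mult_right_mono)
      finally show ?thesis
        by (simp add: algebra_simps)
    qed
    show "((\<lambda>i. l (u i) x - x) \<longlongrightarrow> 0) ?F" if "x \<in> all_values l UNIV UNIV" for x
    proof -
      obtain a y where x: "x = l a y"
        using \<open>x \<in> all_values l UNIV UNIV\<close> unfolding all_values_def by blast
      have "((\<lambda>i. u i * a) \<longlongrightarrow> a) ?F"
        using bai unfolding bounded_approximate_identity_def by blast
      then have "((\<lambda>i. l (u i * a) y) \<longlongrightarrow> l a y) ?F"
        by (rule bounded_linear.tendsto [OF contractive_bilinear_imp_bounded_linear
              [OF contractive_bilinear_flip [OF l(1)]]])
      then show ?thesis
        by (simp add: x l(2) LIM_zero)
    qed
  qed (simp add: nondegenerate)
  then have "((\<lambda>i. l (u i) e) \<longlongrightarrow> e) ?F"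
    by (rule LIM_zero_cancel)
  moreover have "?F \<noteq> bot"
    using bai net_filter_neq_bot unfolding bounded_approximate_identity_def by blast
  ultimately show ?thesis
    by (intro Lim_in_closed_set [where f = "\<lambda>i. l (u i) e" and F = ?F])
      (auto intro!: always_eventually closure_subset [THEN subsetD])
qed

lemma bounded_approximate_identity_right_mem_closure:
  fixes u :: "'i \<Rightarrow> 'a::complex_banach_algebra" and a :: 'a
  assumes "bounded_approximate_identity le u"
  shows "a \<in> closure (range (\<lambda>b. a * b))"
proof (rule Lim_in_closed_set [where f = "\<lambda>i. a * u i" and F = "net_filter le"])
  show "net_filter le \<noteq> bot" "((\<lambda>i. a * u i) \<longlongrightarrow> a) (net_filter le)"
    using assms net_filter_neq_bot unfolding bounded_approximate_identity_def by blast+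
qed (auto intro!: always_eventually closure_subset [THEN subsetD])

lemma closed_contains_closure_range:
  "\<lbrakk>x \<in> closure (range f); closed C; \<And>a. f a \<in> C\<rbrakk> \<Longrightarrow> x \<in> C"
  using closure_minimal [of "range f" C] by blast

section \<open>Morita induction in the presence of approximate identities\<close>

locale morita_equivalence_bai = morita_equivalence lB rA lA rB pB pA
  for lB :: "'b::complex_banach_algebra \<Rightarrow> 'l::complex_banach \<Rightarrow> 'l"
    and rA :: "'l \<Rightarrow> 'a::complex_banach_algebra \<Rightarrow> 'l"
    and lA :: "'a \<Rightarrow> 'r::complex_banach \<Rightarrow> 'r"
    and rB :: "'r \<Rightarrow> 'b \<Rightarrow> 'r"
    and pB :: "'l \<Rightarrow> 'r \<Rightarrow> 'b"
    and pA :: "'r \<Rightarrow> 'l \<Rightarrow> 'a" +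
  fixes leA :: "'i \<Rightarrow> 'i \<Rightarrow> bool" and uA :: "'i \<Rightarrow> 'a"
    and leB :: "'j \<Rightarrow> 'j \<Rightarrow> bool" and uB :: "'j \<Rightarrow> 'b"
  assumes bai_A: "bounded_approximate_identity leA uA"
    and bai_B: "bounded_approximate_identity leB uB"
begin

text \<open>The axioms are symmetric under exchanging the algebras together with the two modules.
  Each result of this locale thus also holds for the reversed induction
  \<open>morita_ind pA pB\<close>.\<close>

lemma swap: "morita_equivalence_bai lA rB lB rA pA pB leB uB leA uA"
  by unfold_locales
    (simp_all add: bimodule_l bimodule_r pairing_A pairing_B pB_left pB_right pA_left pA_right
      pB_balanced pA_balanced pairings_l pairings_r full_A full_B nondegenerate_lB nondegenerate_lA
      nondegenerate_rA nondegenerate_rB bai_A bai_B)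

lemma contractive_lA: "contractive_bilinear lA" and contractive_rB: "contractive_bilinear rB"
  using bimodule_r by (simp_all add: banach_bimodule_def)

text \<open>\<open>x\<close> is a limit of elements \<open>lA a x\<close>. By fullness
  \<open>a\<close> may be replaced by values \<open>pA y e\<close>, and
  \<open>lA (pA y e) x = rB y (pB e x)\<close>. In this way \<open>x\<close> is recovered from its
  pairings \<open>pB e x\<close>.\<close>

lemma mem_closed_subspace_R:
  assumes "closed C" "csubspace C" "\<And>y e. rB y (pB e x) \<in> C"
  shows "x \<in> C"
proof (rule closed_contains_closure_range)
  show "x \<in> closure (range (\<lambda>a. lA a x))"
    using bimodule_r unfolding banach_bimodule_def
    by (intro nondegenerate_left_mem_closure [OF bai_A _ _ nondegenerate_lA]) auto
  have "lA c x \<in> C" if "c \<in> all_values pA UNIV UNIV" for c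
    using that assms(3) by (auto simp flip: pairings_r elim!: all_valuesE)
  then show "lA a x \<in> C" for a
    using contractive_bilinear_closure_cspan_left [OF contractive_lA assms(1,2)] full_A by blast
qed (fact assms(1))

text \<open>\<open>b\<close> is a limit of products \<open>b * c\<close>. By fullness
  \<open>c\<close> may be replaced by values \<open>pB e x\<close>, and
  \<open>b * pB e x = pB (lB b e) x\<close>.\<close>

lemma mem_closed_subspace_B:
  assumes "closed C" "csubspace C" "\<And>e x. pB (lB b e) x \<in> C"
  shows "b \<in> C"
proof (rule closed_contains_closure_range)
  show "b \<in> closure (range (\<lambda>c. b * c))"
    by (rule bounded_approximate_identity_right_mem_closure [OF bai_B])
  have "b * c \<in> C" if "c \<in> all_values pB UNIV UNIV" for c
    using that assms(3) by (auto simp flip: pB_left elim!: all_valuesE)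
  then show "b * c \<in> C" for c
    using contractive_bilinear_closure_cspan_right [OF contractive_bilinear_mult assms(1,2)] full_B
    by blast
qed (fact assms(1))

lemma rB_mem_ideal_submodule:
  assumes "closed_ideal I" "b \<in> I"
  shows "rB y b \<in> ideal_submodule pB I"
  using assms by (simp add: ideal_submodule_def closed_ideal_def pB_right)

lemma lA_mem_ideal_submodule:
  "x \<in> ideal_submodule pB I \<Longrightarrow> lA a x \<in> ideal_submodule pB I"
  by (simp add: ideal_submodule_def flip: pB_balanced)

lemma pA_mem_morita_ind:
  "x \<in> ideal_submodule pB I \<Longrightarrow> pA x e \<in> morita_ind pB pA I"
  unfolding morita_ind_def by (simp add: all_values_mem_closure_cspan)

text \<open>On generators, left multiplication acts on the first entry of \<open>pA\<close>, where
  it preserves the submodule of \<open>I\<close>; right multiplication acts on the second entry,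
  which is unrestricted.\<close>

lemma closed_ideal_morita_ind: "closed_ideal (morita_ind pB pA I)"
  unfolding morita_ind_def
  by (rule closed_ideal_closure_cspan)
    (auto simp: lA_mem_ideal_submodule simp flip: pA_left pA_right
      intro!: all_values_mem_closure_cspan elim!: all_valuesE)

text \<open>This trades the implicitly defined submodule for explicit generators: if all
  \<open>pB e x\<close> lie in \<open>I\<close>, then \<open>x\<close> lies in the closed linear
  span of the elements \<open>rB y b\<close> with \<open>b \<in> I\<close>.\<close>

lemma morita_ind_minimal:
  assumes "closed C" "csubspace C" "\<And>y b e. b \<in> I \<Longrightarrow> pA (rB y b) e \<in> C"
  shows "morita_ind pB pA I \<subseteq> C"
  unfolding morita_ind_def
proof (rule closure_cspan_minimal [OF _ assms(1,2)])
  have "pA x e \<in> C" if "x \<in> ideal_submodule pB I" for x e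
  proof -
    have "x \<in> closure (cspan (all_values rB UNIV I))"
    proof (rule mem_closed_subspace_R)
      show "rB y (pB e x) \<in> closure (cspan (all_values rB UNIV I))" for y e
        using that by (simp add: all_values_mem_closure_cspan ideal_submodule_def)
    qed auto
    moreover have "pA z e \<in> C" if "z \<in> all_values rB UNIV I" for z
      using that assms(3) by (auto elim!: all_valuesE)
    ultimately show ?thesis
      using contractive_bilinear_closure_cspan_left [OF pairing_A assms(1,2)] by blast
  qed
  then show "all_values pA (ideal_submodule pB I) UNIV \<subseteq> C"
    by (auto elim!: all_valuesE)
qed

lemma morita_ind_mono: "I \<subseteq> J \<Longrightarrow> morita_ind pB pA I \<subseteq> morita_ind pB pA J"
  unfolding morita_ind_def
  by (intro closure_mono complex_vector.span_mono) (auto simp: all_values_def ideal_submodule_def)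

lemma morita_ind_swap_morita_ind:
  assumes I: "closed_ideal I"
  shows "morita_ind pA pB (morita_ind pB pA I) = I"
proof
  interpret swap: morita_equivalence_bai lA rB lB rA pA pB leB uB leA uA
    by (rule swap)
  have closed: "closed I" and subspace: "csubspace I"
    using I by (auto simp: closed_ideal_def)
  show "morita_ind pA pB (morita_ind pB pA I) \<subseteq> I"
  proof (rule swap.morita_ind_minimal [OF closed subspace])
    fix f a y assume "a \<in> morita_ind pB pA I"
    then have a: "a \<in> closure (cspan (all_values pA (ideal_submodule pB I) UNIV))"
      by (simp add: morita_ind_def)
    have flip: "contractive_bilinear (\<lambda>y a. lA a y)"
      by (rule contractive_bilinear_flip [OF contractive_lA])
    \<comment> \<open>Balancing turns \<open>pB (rA f a) y\<close> into
      \<open>pB f (lA a y)\<close>, which is bounded and linear in \<open>a\<close>. So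
      \<open>a\<close> may be taken to be \<open>pA x e\<close> with \<open>x\<close> in the
      submodule of \<open>I\<close>; the value is then
      \<open>pB f (rB x (pB e y)) = pB f x * pB e y\<close>, whose first factor lies in
      \<open>I\<close>.\<close>
    have "Vector_Spaces.linear scaleC scaleC (pB f \<circ> (\<lambda>a. lA a y))"
      by (rule Vector_Spaces.linear_compose [OF contractive_bilinear_imp_linear [OF flip]
            contractive_bilinear_imp_linear [OF pairing_B]])
    moreover have "bounded_linear (pB f \<circ> (\<lambda>a. lA a y))"
      unfolding o_def
      by (rule bounded_linear_compose [OF contractive_bilinear_imp_bounded_linear [OF pairing_B]
            contractive_bilinear_imp_bounded_linear [OF flip]])
    moreover have "(pB f \<circ> (\<lambda>a. lA a y)) c \<in> I"
      if "c \<in> all_values pA (ideal_submodule pB I) UNIV" for c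
      using that I
      by (auto simp: pB_right ideal_submodule_def closed_ideal_def simp flip: pairings_r
          elim!: all_valuesE)
    ultimately have "(pB f \<circ> (\<lambda>a. lA a y)) a \<in> I"
      by (rule linear_closure_cspan_mem [OF _ _ closed subspace _ a])
    then have "pB f (lA a y) \<in> I"
      by simp
    then show "pB (rA f a) y \<in> I"
      by (simp add: pB_balanced)
  qed
  show "I \<subseteq> morita_ind pA pB (morita_ind pB pA I)"
  proof
    fix b assume "b \<in> I"
    \<comment> \<open>Balancing gives \<open>pA y (lB b e) = pA (rB y b) e\<close>, and
      \<open>rB y b\<close> belongs to the submodule of \<open>I\<close>.\<close>
    then have lB: "lB b e \<in> ideal_submodule pA (morita_ind pB pA I)" for e
      using pA_mem_morita_ind rB_mem_ideal_submodule [OF I]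
      by (simp add: ideal_submodule_def flip: pA_balanced)
    show "b \<in> morita_ind pA pB (morita_ind pB pA I)"
    proof (rule mem_closed_subspace_B)
      show "pB (lB b e) x \<in> morita_ind pA pB (morita_ind pB pA I)" for e x
        by (rule swap.pA_mem_morita_ind [OF lB])
    qed (use swap.closed_ideal_morita_ind in \<open>simp_all add: closed_ideal_def\<close>)
  qed
qed

section \<open>Dense subcontexts and geometric ideals\<close>

lemma morita_ind_geometric:
  assumes dense: "compatible_dense_subcontext lB rA lA rB pB pA A0 B0 L0 R0"
    and I: "I \<in> geometric_ideals B0"
  shows "morita_ind pB pA I \<in> geometric_ideals A0"
proof -
  let ?J = "morita_ind pB pA I"
  let ?C = "closure (?J \<inter> A0)"
  have ideal: "closed_ideal I" and clI: "closure (I \<inter> B0) = I"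
    using I by (auto simp: geometric_ideals_def)
  have sub: "csubspace A0" "csubspace B0" "csubspace L0" "csubspace R0"
    and cl: "closure L0 = UNIV" "closure R0 = UNIV"
    and incl: "cspan (all_values rB R0 B0) \<subseteq> R0" "all_values pA R0 L0 \<subseteq> A0"
    using dense unfolding compatible_dense_subcontext_def dense_subalgebra_def dense_subspace_def
      subalgebra_def by blast+
  have C: "closed ?C" "csubspace ?C"
    using closed_ideal_morita_ind [of I] sub(1)
    by (auto simp: closed_ideal_def intro!: csubspace_closure complex_vector.subspace_inter)
  \<comment> \<open>Subspaces are their own spans, so the extension lemmas for
    \<open>closure (cspan _)\<close> apply to these dense sets. In \<open>pA (rB y b) e\<close> the
    entries \<open>e\<close>, \<open>y\<close> and \<open>b\<close> are then freed from the
    subcontext one after another.\<close>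
  have span: "cspan L0 = L0" "cspan R0 = R0" "cspan (I \<inter> B0) = I \<inter> B0"
    using sub ideal by (auto simp: closed_ideal_def intro!: complex_vector.subspace_inter)
  have base: "pA (rB y b) e \<in> ?C" if "y \<in> R0" "b \<in> I \<inter> B0" "e \<in> L0" for y b e
  proof -
    have "rB y b \<in> R0"
      using incl(1) that by (auto simp: all_values_def intro: complex_vector.span_base)
    then have "pA (rB y b) e \<in> A0"
      using incl(2) that(3) by (auto simp: all_values_def)
    moreover have "pA (rB y b) e \<in> ?J"
      using that by (simp add: pA_mem_morita_ind rB_mem_ideal_submodule [OF ideal])
    ultimately show ?thesis
      by (intro subsetD [OF closure_subset] IntI)
  qed
  have R0: "pA (rB y b) e \<in> ?C" if "y \<in> R0" "b \<in> I \<inter> B0" for y b e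
  proof (rule contractive_bilinear_closure_cspan_right [OF pairing_A C])
    show "e \<in> closure (cspan L0)"
      by (simp add: span cl)
  qed (rule base [OF that])
  \<comment> \<open>Moving \<open>b\<close> to the other entry leaves \<open>y\<close> as the first
    argument of \<open>pA\<close>, where density of \<open>R0\<close> can be used directly.\<close>
  have step: "pA (rB y b) e \<in> ?C" if "b \<in> I \<inter> B0" for y b e
    unfolding pA_balanced
  proof (rule contractive_bilinear_closure_cspan_left [OF pairing_A C])
    show "y \<in> closure (cspan R0)"
      by (simp add: span cl)
    show "pA z (lB b e) \<in> ?C" if "z \<in> R0" for z
      using R0 [OF that \<open>b \<in> I \<inter> B0\<close>] by (simp add: pA_balanced)
  qed
  have "?J \<subseteq> ?C"
  proof (rule morita_ind_minimal [OF C])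
    fix y b e assume "b \<in> I"
    let ?S = "all_values rB UNIV (I \<inter> B0)"
    \<comment> \<open>Geometricity of \<open>I\<close> enters here: \<open>b\<close> is a limit of
      elements of \<open>I \<inter> B0\<close>.\<close>
    have "rB y b \<in> closure (cspan ?S)"
    proof (rule contractive_bilinear_closure_cspan_right [OF contractive_rB])
      show "b \<in> closure (cspan (I \<inter> B0))"
        using \<open>b \<in> I\<close> by (simp add: span clI)
    qed (simp_all add: all_values_mem_closure_cspan)
    moreover have "pA z e \<in> ?C" if "z \<in> ?S" for z
      using that by (elim all_valuesE) (simp add: step)
    ultimately show "pA (rB y b) e \<in> ?C"
      using contractive_bilinear_closure_cspan_left [OF pairing_A C] by blast
  qed
  moreover have "?C \<subseteq> ?J"
    using closed_ideal_morita_ind by (intro closure_minimal) (auto simp: closed_ideal_def)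
  ultimately show ?thesis
    using closed_ideal_morita_ind by (auto simp: geometric_ideals_def)
qed

end

section \<open>Symmetry of subcontexts and the order isomorphism\<close>

lemma compatible_dense_subcontext_swap:
  "compatible_dense_subcontext lB rA lA rB pB pA A0 B0 L0 R0 \<Longrightarrow>
   compatible_dense_subcontext lA rB lB rA pA pB B0 A0 R0 L0"
  by (auto simp: compatible_dense_subcontext_def)

theorem theorem3p3:
  fixes leA :: "'i \<Rightarrow> 'i \<Rightarrow> bool" and uA :: "'i \<Rightarrow> 'a::complex_banach_algebra"
    and leB :: "'j \<Rightarrow> 'j \<Rightarrow> bool" and uB :: "'j \<Rightarrow> 'b::complex_banach_algebra"
    and lB :: "'b \<Rightarrow> 'l::complex_banach \<Rightarrow> 'l" and rA :: "'l \<Rightarrow> 'a \<Rightarrow> 'l"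
    and lA :: "'a \<Rightarrow> 'r::complex_banach \<Rightarrow> 'r" and rB :: "'r \<Rightarrow> 'b \<Rightarrow> 'r"
    and pB :: "'l \<Rightarrow> 'r \<Rightarrow> 'b" and pA :: "'r \<Rightarrow> 'l \<Rightarrow> 'a"
    and A0 :: "'a set" and B0 :: "'b set" and L0 :: "'l set" and R0 :: "'r set"
  assumes "bounded_approximate_identity leA uA"
    and "bounded_approximate_identity leB uB"
    and "morita_equivalence lB rA lA rB pB pA"
    and "compatible_dense_subcontext lB rA lA rB pB pA A0 B0 L0 R0"
  shows "(\<forall>I. closed_ideal I \<longrightarrow>
            (I \<in> geometric_ideals B0 \<longleftrightarrow> morita_ind pB pA I \<in> geometric_ideals A0)) \<and>
         inclusion_isomorphism (morita_ind pB pA) (geometric_ideals B0) (geometric_ideals A0)"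
proof -
  interpret morita_equivalence_bai lB rA lA rB pB pA leA uA leB uB
    using assms(1-3) by (simp add: morita_equivalence_bai_def morita_equivalence_bai_axioms_def)
  interpret swap: morita_equivalence_bai lA rB lB rA pA pB leB uB leA uA
    by (rule swap)
  let ?ind = "morita_ind pB pA" and ?ind' = "morita_ind pA pB"
  have geometric: "?ind I \<in> geometric_ideals A0" if "I \<in> geometric_ideals B0" for I
    by (rule morita_ind_geometric [OF assms(4) that])
  have geometric': "?ind' J \<in> geometric_ideals B0" if "J \<in> geometric_ideals A0" for J
    by (rule swap.morita_ind_geometric [OF compatible_dense_subcontext_swap [OF assms(4)] that])
  have ideal: "closed_ideal I" if "I \<in> geometric_ideals S" for I and S :: "'c::complex_banach_algebra set"
    using that by (simp add: geometric_ideals_def)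
  have inverse: "?ind' (?ind I) = I" if "closed_ideal I" for I
    by (rule morita_ind_swap_morita_ind [OF that])
  have inverse': "?ind (?ind' J) = J" if "closed_ideal J" for J
    by (rule swap.morita_ind_swap_morita_ind [OF that])
  \<comment> \<open>For the converse, \<open>?ind'\<close> sends the geometric ideal
    \<open>?ind I\<close> to a geometric ideal, which is \<open>I\<close> itself.\<close>
  have "I \<in> geometric_ideals B0 \<longleftrightarrow> ?ind I \<in> geometric_ideals A0" if "closed_ideal I" for I
    using geometric geometric' inverse [OF that] by metis
  moreover have "bij_betw ?ind (geometric_ideals B0) (geometric_ideals A0)"
    by (rule bij_betwI [where g = ?ind']) (auto simp: geometric geometric' inverse inverse' ideal)
  \<comment> \<open>Order is reflected because the inverse \<open>?ind'\<close> is monotone as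
    well.\<close>
  moreover have "I \<subseteq> J \<longleftrightarrow> ?ind I \<subseteq> ?ind J"
    if "I \<in> geometric_ideals B0" "J \<in> geometric_ideals B0" for I J
    using morita_ind_mono swap.morita_ind_mono inverse ideal that by metis
  ultimately show ?thesis
    by (auto simp: inclusion_isomorphism_def)
qed

end
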